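(* Suppose $(X,d)$ is a metric space and $h:X\to X$ is an almost periodic homeomorphism of $(X,d)$. Then $h$ is compactly almost periodic if and only if for every $x\in X$ the set $\overline{\{h^{n}(x) : n\in\mathbb{Z}\}}$ is locally complete with respect to $d$.
   Context: A homeomorphism $h$ of a metric space $(X,d)$ is almost periodic if for each $\varepsilon>0$ there is an integer $N\ge 0$ such that for every $M\in\mathbb{Z}$ there is an integer $i$ with $M\le i\le M+N$ and $d(h^{i}(x),x)<\varepsilon$ for all $x\in X$. A homeomorphism $h$ of a metrizable space $X$ is compactly almost periodic if (i) $\overline{\bigcup_{n\in\mathbb{Z}}h^{n}(B)}$ is compact for each compact $B\subset X$, and (ii) for each compact $A\subset X$ with $h(A)=A$, the restriction $h|_{A}:A\to A$ is an almost periodic homeomorphism of $A$ (with respect to a metric on $A$ inducing its topology; since $A$ is compact the choice of metric is immaterial). A metric space $(Y,d)$ is locally complete if for each $y\in Y$ there is $\varepsilon>0$ such that the closure $\overline{B(y,\varepsilon)}$ (in $Y$) of the ball is complete with respect to $d$; a subset of $X$ is locally complete with respect to $d$ if it is so as a metric subspace. *)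

theory Defs
  imports "HOL-Analysis.Analysis"
begin

(* The iterates h^n for integer n of a bijection h of S onto itself. For negative n the inverse
   is taken relative to S, so that the values of h outside S are irrelevant. *)
definition int_iterate :: "'a set \<Rightarrow> ('a \<Rightarrow> 'a) \<Rightarrow> int \<Rightarrow> 'a \<Rightarrow> 'a" where
  "int_iterate S h n =
     (if 0 \<le> n then h ^^ nat n else (inv_into S h) ^^ nat (- n))"

context Metric_space
begin

definition almost_periodic :: "('a \<Rightarrow> 'a) \<Rightarrow> bool" where
  "almost_periodic h \<longleftrightarrow>
     homeomorphic_map mtopology mtopology h \<and>
     (\<forall>\<epsilon>>0. \<exists>N::nat. \<forall>m::int. \<exists>i. m \<le> i \<and> i \<le> m + int N \<and>
        (\<forall>x\<in>M. d (int_iterate M h i x) x < \<epsilon>))"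

definition locally_mcomplete :: bool where
  "locally_mcomplete \<longleftrightarrow>
     (\<forall>y\<in>M. \<exists>\<epsilon>>0. Metric_space.mcomplete (mtopology closure_of mball y \<epsilon>) d)"

end

(* In the last clause, Metric_space.almost_periodic A d only looks at h on A, i.e. at the
   restriction of h to A. As A is compact, all metrics d inducing its topology are uniformly
   equivalent, so it does not matter which one is chosen. *)
definition compactly_almost_periodic :: "'a topology \<Rightarrow> ('a \<Rightarrow> 'a) \<Rightarrow> bool" where
  "compactly_almost_periodic X h \<longleftrightarrow>
     metrizable_space X \<and>
     homeomorphic_map X X h \<and>
     (\<forall>B. compactin X B \<longrightarrow>
        compactin X (X closure_of (\<Union>n::int. int_iterate (topspace X) h n ` B))) \<and>
     (\<forall>A. compactin X A \<and> h ` A = A \<longrightarrow>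
        (\<exists>d. Metric_space A d \<and> Metric_space.mtopology A d = subtopology X A \<and>
             Metric_space.almost_periodic A d h))"

end

theory Submission
  imports Defs
begin

text \<open>
  Almost periodicity says that every integer is, up to a remainder in a finite range
  \<open>{0..N}\<close>, an exponent whose iterate of \<open>h\<close> moves no point by more than \<open>\<epsilon>\<close>. So up to
  \<open>\<epsilon>\<close> all iterates of \<open>h\<close> look like the finitely many maps \<open>h ^^ r\<close> with \<open>r \<le> N\<close>. Two
  consequences follow at once: the iterates are equicontinuous at every point
  (\<open>almost_periodic_equicontinuous\<close>), and every orbit is totally bounded
  (\<open>almost_periodic_orbit_mtotally_bounded\<close>).

  Now let the closure of the orbit of \<open>x\<close> be locally complete. Some ball about \<open>x\<close> in this closure
  then has a closure \<open>K\<close> that is complete and totally bounded, hence compact. Taking the radius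
  of that ball as \<open>\<epsilon>\<close>, the whole orbit lies in the union of the finitely many compact sets
  \<open>(h ^^ r) ` K\<close>, so the orbit closure is compact
  (\<open>almost_periodic_compact_orbit_closure\<close>). To pass from points to a compact set \<open>B\<close>, take
  images of points \<open>b\<^sub>k\<close> of \<open>B\<close> under iterates with exponents \<open>n\<^sub>k\<close>, and let \<open>b\<^sub>k\<close> converge to
  \<open>b\<close> along a subsequence; by equicontinuity the images of \<open>b\<^sub>k\<close> are asymptotic to those of \<open>b\<close>
  under the same iterates, and these lie in a single orbit, so some subsequence of them converges
  (\<open>almost_periodic_compact_saturation\<close>).

  Almost periodicity on an invariant compact set is inherited from \<open>X\<close> by restricting \<open>d\<close>.
  Conversely, if \<open>h\<close> is compactly almost periodic, the case \<open>B = {x}\<close> of the first condition makes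
  the orbit closure of \<open>x\<close> compact; closures of balls in it are then compact too, hence complete.
\<close>

section \<open>Integer iterates of a bijection\<close>

lemma int_iterate_of_nat [simp]: "int_iterate S h (int r) = h ^^ r"
  by (simp add: int_iterate_def)

lemma int_iterate_minus_of_nat [simp]: "int_iterate S h (- int k) = inv_into S h ^^ k"
  by (cases "k = 0") (simp_all add: int_iterate_def)

lemma int_iterate_0 [simp]: "int_iterate S h 0 x = x"
  by (simp add: int_iterate_def)

lemma funpow_in:
  assumes "f ` S \<subseteq> S" "x \<in> S"
  shows "(f ^^ n) x \<in> S"
  using assms by (induction n) auto

lemma int_iterate_in:
  assumes "bij_betw h S S" "x \<in> S"
  shows "int_iterate S h n x \<in> S"
proof -
  have "h ` S \<subseteq> S" "inv_into S h ` S \<subseteq> S"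
    using assms(1) by (auto simp: bij_betw_def intro!: inv_into_into)
  then show ?thesis
    using assms(2) by (simp add: int_iterate_def funpow_in)
qed

lemma int_iterate_Suc:
  assumes "bij_betw h S S" "x \<in> S"
  shows "int_iterate S h (n + 1) x = h (int_iterate S h n x)"
proof (cases "0 \<le> n")
  case True
  then show ?thesis
    by (simp add: int_iterate_def nat_add_distrib)
next
  case False
  define k where "k = nat (- n - 1)"
  with False have n: "n = - int (Suc k)"
    by simp
  have "(inv_into S h ^^ k) x \<in> S"
    using int_iterate_in[OF assms, of "- int k"] by simp
  then have "h (inv_into S h ((inv_into S h ^^ k) x)) = (inv_into S h ^^ k) x"
    using assms by (simp add: bij_betw_inv_into_right)
  moreover have "int_iterate S h (n + 1) x = (inv_into S h ^^ k) x"
    using int_iterate_minus_of_nat[of S h k] by (simp add: n)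
  moreover have "int_iterate S h n x = (inv_into S h ^^ Suc k) x"
    unfolding n int_iterate_minus_of_nat ..
  ultimately show ?thesis
    by simp
qed

lemma int_iterate_add:
  assumes h: "bij_betw h S S" and x: "x \<in> S"
  shows "int_iterate S h (m + n) x = int_iterate S h m (int_iterate S h n x)"
proof (induction m rule: int_induct[where k = 0])
  case (step1 m)
  have "int_iterate S h (m + 1 + n) x = int_iterate S h (m + n + 1) x"
    by (simp add: algebra_simps)
  then show ?case
    using step1 assms by (simp add: int_iterate_Suc int_iterate_in)
next
  case (step2 m)
  \<comment> \<open>Apply \<open>h\<close> to both sides to reach the exponent of the induction hypothesis, then cancel it.\<close>
  have "h (int_iterate S h (m - 1 + n) x) = int_iterate S h (m - 1 + n + 1) x"
    using assms by (simp only: int_iterate_Suc)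
  also have "\<dots> = int_iterate S h (m - 1 + 1) (int_iterate S h n x)"
    using step2 by simp
  also have "\<dots> = h (int_iterate S h (m - 1) (int_iterate S h n x))"
    using assms by (simp only: int_iterate_Suc int_iterate_in)
  finally show ?case
    using assms by (meson bij_betw_def inj_onD int_iterate_in)
qed simp

text \<open>Negative iterates involve an inverse chosen relative to the carrier, and restricting \<open>h\<close> to an
  invariant set keeps them because injectivity makes the two inverses agree there.\<close>

lemma int_iterate_subset:
  assumes h: "bij_betw h S S" and A: "A \<subseteq> S" "h ` A = A" and x: "x \<in> A"
  shows "int_iterate A h n x = int_iterate S h n x"
proof -
  have inj: "inj_on h S"
    using h by (simp add: bij_betw_def)
  have inv: "inv_into A h y = inv_into S h y \<and> inv_into S h y \<in> A" if "y \<in> A" for y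
  proof -
    have "y \<in> h ` A"
      using that A(2) by simp
    then obtain z where "z \<in> A" "y = h z" ..
    with A(1) show ?thesis
      by (simp add: inv_into_f_f[OF inj] inv_into_f_f[OF inj_on_subset[OF inj A(1)]] subsetD)
  qed
  have "(inv_into A h ^^ k) x = (inv_into S h ^^ k) x \<and> (inv_into S h ^^ k) x \<in> A" for k
    by (induction k) (use x inv in auto)
  then show ?thesis
    by (simp add: int_iterate_def)
qed

section \<open>Almost periodic homeomorphisms\<close>

context Metric_space
begin

lemma compactin_iff_mcomplete_mtotally_bounded:
  assumes "S \<subseteq> M"
  shows "compactin mtopology S \<longleftrightarrow> Metric_space.mcomplete S d \<and> mtotally_bounded S"
proof -
  interpret S: Submetric M d S
    using assms by unfold_locales
  show ?thesis
    using assms mtotally_bounded_absolute[of S]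
    by (simp add: compactin_subspace flip: S.mtopology_submetric)
      (simp add: S.sub.compact_space_eq_mcomplete_mtotally_bounded)
qed

lemma compact_closure_of_sequentially:
  assumes "S \<subseteq> M"
  shows "compactin mtopology (mtopology closure_of S) \<longleftrightarrow>
    (\<forall>\<sigma>::nat \<Rightarrow> 'a. range \<sigma> \<subseteq> S \<longrightarrow>
      (\<exists>l r. strict_mono r \<and> limitin mtopology (\<sigma> \<circ> r) l sequentially))"
proof -
  have "M \<inter> mtopology derived_set_of T = mtopology derived_set_of T" for T
    using derived_set_of_subset_topspace[of mtopology T] by auto
  then show ?thesis
    using Bolzano_Weierstrass_property[OF assms assms] assms
      Bolzano_Weierstrass_property[of S M]
    unfolding compact_closure_of_eq_Bolzano_Weierstrass
    by (smt (verit) limitin_mspace subset_trans)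
qed

lemma almost_periodic_bij_betw: "almost_periodic h \<Longrightarrow> bij_betw h M M"
  by (metis almost_periodic_def bij_betw_def homeomorphic_imp_injective_map
      homeomorphic_imp_surjective_map topspace_mtopology)

lemma almost_periodic_continuous_funpow:
  assumes "almost_periodic h"
  shows "continuous_map mtopology mtopology (h ^^ r)"
proof (induction r)
  case (Suc r)
  have "continuous_map mtopology mtopology h"
    using assms by (simp add: almost_periodic_def homeomorphic_imp_continuous_map)
  with Suc show ?case
    unfolding funpow.simps by (rule continuous_map_compose)
qed (simp add: id_def)

text \<open>The form in which almost periodicity is used: the almost periods have bounded gaps, so any
  exponent is an almost period plus a remainder that takes finitely many values.\<close>

lemma almost_periodic_remainder:
  assumes "almost_periodic h" "\<epsilon> > 0"
  obtains N :: nat where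
    "\<And>n. \<exists>i r. n = i + int r \<and> r \<le> N \<and> (\<forall>x\<in>M. d (int_iterate M h i x) x < \<epsilon>)"
proof -
  obtain N :: nat where N: "\<And>m::int. \<exists>i. m \<le> i \<and> i \<le> m + int N \<and>
      (\<forall>x\<in>M. d (int_iterate M h i x) x < \<epsilon>)"
    using assms by (meson almost_periodic_def)
  have "\<exists>i r. n = i + int r \<and> r \<le> N \<and> (\<forall>x\<in>M. d (int_iterate M h i x) x < \<epsilon>)" for n
  proof -
    obtain i where i: "n - int N \<le> i" "i \<le> n" "\<forall>x\<in>M. d (int_iterate M h i x) x < \<epsilon>"
      using N[of "n - int N"] by auto
    then have "n = i + int (nat (n - i)) \<and> nat (n - i) \<le> N"
      by linarith
    with i show ?thesis
      by blast
  qed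
  with that show thesis
    by blast
qed

text \<open>Every iterate is uniformly \<open>\<epsilon>/3\<close>-close to one of finitely many continuous maps
  \<open>h ^^ r\<close>, and a finite family of continuous maps is equicontinuous at each point.\<close>

lemma almost_periodic_equicontinuous:
  assumes h: "almost_periodic h" and x: "x \<in> M" and "\<epsilon> > 0"
  obtains \<delta> where "\<delta> > 0"
    "\<And>y n. y \<in> M \<Longrightarrow> d x y < \<delta> \<Longrightarrow> d (int_iterate M h n x) (int_iterate M h n y) < \<epsilon>"
proof -
  note bij = almost_periodic_bij_betw[OF h]
  obtain N where N: "\<And>n. \<exists>i r. n = i + int r \<and> r \<le> N \<and>
      (\<forall>x\<in>M. d (int_iterate M h i x) x < \<epsilon>/3)"
    using almost_periodic_remainder[OF h, of "\<epsilon>/3"] \<open>\<epsilon> > 0\<close> by auto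
  have "\<exists>\<delta>>0. \<forall>y. y \<in> M \<and> d x y < \<delta> \<longrightarrow> d ((h ^^ r) x) ((h ^^ r) y) < \<epsilon>/3" for r
  proof -
    have "\<epsilon>/3 > 0"
      using \<open>\<epsilon> > 0\<close> by simp
    with x show ?thesis
      using almost_periodic_continuous_funpow[OF h, of r]
      unfolding metric_continuous_map[OF Metric_space_axioms] by blast
  qed
  then obtain \<delta> where \<delta>: "\<And>r. \<delta> r > 0"
    "\<And>r y. y \<in> M \<Longrightarrow> d x y < \<delta> r \<Longrightarrow> d ((h ^^ r) x) ((h ^^ r) y) < \<epsilon>/3"
    by metis
  show thesis
  proof
    show "Min (\<delta> ` {..N}) > 0"
      using \<delta> by simp
  next
    fix y n
    assume y: "y \<in> M" "d x y < Min (\<delta> ` {..N})"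
    obtain i r where ir: "n = i + int r" "r \<le> N"
      and i: "\<forall>x\<in>M. d (int_iterate M h i x) x < \<epsilon>/3"
      using N by blast
    let ?f = "int_iterate M h i" and ?x = "(h ^^ r) x" and ?y = "(h ^^ r) y"
    have xy: "?x \<in> M" "?y \<in> M"
      using int_iterate_in[OF bij x, of "int r"] int_iterate_in[OF bij y(1), of "int r"] by simp_all
    note M = xy int_iterate_in[OF bij xy(1), of i] int_iterate_in[OF bij xy(2), of i]
    have "d ?x ?y < \<epsilon>/3"
      using \<delta>(2)[of y r] y ir by simp
    moreover have "d (?f ?x) ?x < \<epsilon>/3" "d (?f ?y) ?y < \<epsilon>/3"
      using i M by auto
    moreover have "d (?f ?x) (?f ?y) \<le> d (?f ?x) ?x + d ?x ?y + d (?f ?y) ?y"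
      using triangle[of "?f ?x" ?x "?f ?y"] triangle[of ?x ?y "?f ?y"] commute[of ?y "?f ?y"] M
      by linarith
    ultimately show "d (int_iterate M h n x) (int_iterate M h n y) < \<epsilon>"
      using int_iterate_add[OF bij x, of i "int r"] int_iterate_add[OF bij y(1), of i "int r"]
      by (simp add: ir)
  qed
qed

text \<open>The first \<open>N + 1\<close> points of the forward orbit form an \<open>\<epsilon>\<close>-net of the whole orbit, because the
  almost period in the decomposition of an exponent can be applied last.\<close>

lemma almost_periodic_orbit_mtotally_bounded:
  assumes h: "almost_periodic h" and x: "x \<in> M"
  shows "mtotally_bounded (range (\<lambda>n. int_iterate M h n x))" (is "mtotally_bounded ?O")
  unfolding mtotally_bounded_def
proof (intro strip)
  fix \<epsilon> :: real
  assume "\<epsilon> > 0"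
  note bij = almost_periodic_bij_betw[OF h]
  obtain N where N: "\<And>n. \<exists>i r. n = i + int r \<and> r \<le> N \<and>
      (\<forall>x\<in>M. d (int_iterate M h i x) x < \<epsilon>)"
    using almost_periodic_remainder[OF h \<open>\<epsilon> > 0\<close>] by blast
  let ?K = "(\<lambda>r. int_iterate M h (int r) x) ` {..N}"
  have "int_iterate M h n x \<in> (\<Union>y\<in>?K. mball y \<epsilon>)" for n
  proof -
    obtain i r where ir: "n = i + int r" "r \<le> N"
      and i: "\<forall>x\<in>M. d (int_iterate M h i x) x < \<epsilon>"
      using N by blast
    let ?y = "int_iterate M h (int r) x"
    have "?y \<in> M"
      using bij x by (rule int_iterate_in)
    moreover have "int_iterate M h n x = int_iterate M h i ?y"
      using ir bij x by (simp only: int_iterate_add)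
    ultimately have "int_iterate M h n x \<in> mball ?y \<epsilon>"
      using i bij by (simp add: commute int_iterate_in del: int_iterate_of_nat)
    with ir show ?thesis
      by blast
  qed
  then show "\<exists>K. finite K \<and> K \<subseteq> ?O \<and> ?O \<subseteq> (\<Union>y\<in>K. mball y \<epsilon>)"
    by (intro exI[of _ ?K]) blast
qed

section \<open>Compactness of orbit closures\<close>

text \<open>The orbit returns to a complete, hence compact, neighbourhood of \<open>x\<close> in its closure with
  bounded gaps, so finitely many translates of this neighbourhood cover the orbit.\<close>

lemma almost_periodic_compact_orbit_closure:
  assumes h: "almost_periodic h" and x: "x \<in> M"
  defines "Q \<equiv> mtopology closure_of range (\<lambda>n. int_iterate M h n x)"
  assumes "Metric_space.locally_mcomplete Q d"
  shows "compactin mtopology Q"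
proof -
  note bij = almost_periodic_bij_betw[OF h]
  let ?O = "range (\<lambda>n. int_iterate M h n x)"
  have OM: "?O \<subseteq> M"
    using int_iterate_in[OF bij x] by blast
  have QM: "Q \<subseteq> M"
    using closure_of_subset_topspace[of mtopology] by (auto simp: Q_def)
  have OQ: "?O \<subseteq> Q"
    using OM by (simp add: Q_def closure_of_subset)
  then have xQ: "x \<in> Q"
    by (metis int_iterate_0 rangeI subsetD)
  interpret Q: Submetric M d Q
    using QM by unfold_locales
  obtain \<epsilon> where "\<epsilon> > 0"
    and "Metric_space.mcomplete (Q.sub.mtopology closure_of Q.sub.mball x \<epsilon>) d"
    using assms(4) xQ by (auto simp: Q.sub.locally_mcomplete_def)
  moreover define K where "K = Q.sub.mtopology closure_of Q.sub.mball x \<epsilon>"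
  ultimately have K: "Metric_space.mcomplete K d"
    by simp
  have KQ: "K \<subseteq> Q"
    using closure_of_subset_topspace[of Q.sub.mtopology] by (auto simp: K_def)
  have "mtotally_bounded Q"
    using almost_periodic_orbit_mtotally_bounded[OF h x]
    by (simp add: Q_def mtotally_bounded_closure_of)
  then have "compactin mtopology K"
    using K KQ QM mtotally_bounded_subset
    by (subst compactin_iff_mcomplete_mtotally_bounded) auto
  then have "compactin mtopology ((h ^^ r) ` K)" for r
    using almost_periodic_continuous_funpow[OF h] by (rule image_compactin)
  then have comp: "compactin mtopology (\<Union>r\<in>{..N}. (h ^^ r) ` K)" for N :: nat
    by (intro compactin_Union) auto
  obtain N where N: "\<And>n. \<exists>i r. n = i + int r \<and> r \<le> N \<and>
      (\<forall>x\<in>M. d (int_iterate M h i x) x < \<epsilon>)"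
    using almost_periodic_remainder[OF h \<open>\<epsilon> > 0\<close>] by blast
  have "int_iterate M h n x \<in> (\<Union>r\<in>{..N}. (h ^^ r) ` K)" for n
  proof -
    obtain i r where ir: "n = i + int r" "r \<le> N"
      and i: "\<forall>x\<in>M. d (int_iterate M h i x) x < \<epsilon>"
      using N by blast
    have "int_iterate M h i x \<in> Q.sub.mball x \<epsilon>"
      using i x xQ OQ by (auto simp: Q.sub.commute)
    moreover have "Q.sub.mball x \<epsilon> \<subseteq> K"
      unfolding K_def by (rule closure_of_subset) auto
    \<comment> \<open>Applying the almost period first lands in \<open>K\<close>, which the remainder then translates.\<close>
    moreover have "int_iterate M h n x = (h ^^ r) (int_iterate M h i x)"
      using int_iterate_add[OF bij x, of "int r" i] by (simp add: ir add.commute)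
    ultimately show ?thesis
      using ir by blast
  qed
  then have "?O \<subseteq> (\<Union>r\<in>{..N}. (h ^^ r) ` K)"
    by blast
  moreover have "closedin mtopology (\<Union>r\<in>{..N}. (h ^^ r) ` K)"
    using comp Hausdorff_space_mtopology by (rule compactin_imp_closedin[rotated])
  ultimately have "Q \<subseteq> (\<Union>r\<in>{..N}. (h ^^ r) ` K)"
    unfolding Q_def by (rule closure_of_minimal)
  with comp show ?thesis
    unfolding Q_def by (meson closed_compactin closedin_closure_of)
qed

text \<open>By equicontinuity, a sequence in the union of the orbits of points of \<open>B\<close> is asymptotic,
  along a subsequence, to a sequence in the orbit of a single point of \<open>B\<close>.\<close>

lemma almost_periodic_compact_saturation:
  assumes h: "almost_periodic h" and B: "compactin mtopology B"
    and orbits: "\<And>x. x \<in> B \<Longrightarrow>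
      compactin mtopology (mtopology closure_of range (\<lambda>n. int_iterate M h n x))"
  shows "compactin mtopology (mtopology closure_of (\<Union>n::int. int_iterate M h n ` B))"
proof -
  note bij = almost_periodic_bij_betw[OF h]
  have BM: "B \<subseteq> M"
    using compactin_subset_topspace[OF B] by simp
  have in_M: "int_iterate M h n x \<in> M" if "x \<in> B" for n x
    using that BM by (intro int_iterate_in[OF bij]) blast
  have "\<exists>l r. strict_mono r \<and> limitin mtopology (\<sigma> \<circ> r) l sequentially"
    if \<sigma>: "range \<sigma> \<subseteq> (\<Union>n::int. int_iterate M h n ` B)" for \<sigma> :: "nat \<Rightarrow> 'a"
  proof -
    have "\<exists>n b. b \<in> B \<and> \<sigma> k = int_iterate M h n b" for k
      using \<sigma> by blast
    then obtain n b where nb: "\<And>k. b k \<in> B" "\<And>k. \<sigma> k = int_iterate M h (n k) (b k)"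
      by metis
    then have "range b \<subseteq> B"
      by blast
    then obtain a r where a: "a \<in> B" and r: "strict_mono r"
      and lim_b: "limitin mtopology (b \<circ> r) a sequentially"
      using B unfolding compactin_sequentially by blast
    let ?\<tau> = "\<lambda>k. int_iterate M h (n (r k)) a"
    have "range ?\<tau> \<subseteq> range (\<lambda>n. int_iterate M h n a)"
      by blast
    moreover have "range (\<lambda>n. int_iterate M h n a) \<subseteq> M"
      using in_M[OF a] by blast
    ultimately obtain l s where s: "strict_mono s"
      and lim_\<tau>: "limitin mtopology (?\<tau> \<circ> s) l sequentially"
      using orbits[OF a] compact_closure_of_sequentially by metis
    have "limitin mtopology (\<sigma> \<circ> (r \<circ> s)) l sequentially"
      unfolding limitin_metric
    proof (intro conjI strip)
      show "l \<in> M"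
        using lim_\<tau> by (rule limitin_mspace)
      fix \<epsilon> :: real
      assume "\<epsilon> > 0"
      obtain \<delta> where "\<delta> > 0" and \<delta>: "\<And>y n. y \<in> M \<Longrightarrow> d a y < \<delta> \<Longrightarrow>
          d (int_iterate M h n a) (int_iterate M h n y) < \<epsilon>/2"
        using almost_periodic_equicontinuous[OF h, of a "\<epsilon>/2"] a BM \<open>\<epsilon> > 0\<close> by auto
      have "limitin mtopology (b \<circ> r \<circ> s) a sequentially"
        using lim_b s by (rule limitin_subsequence[rotated])
      then have "\<forall>\<^sub>F k in sequentially. d (b (r (s k))) a < \<delta>"
        using \<open>\<delta> > 0\<close> by (auto simp: limitin_metric elim: eventually_mono)
      moreover have "\<forall>\<^sub>F k in sequentially. ?\<tau> (s k) \<in> M \<and> d (?\<tau> (s k)) l < \<epsilon>/2"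
        using lim_\<tau> half_gt_zero[OF \<open>\<epsilon> > 0\<close>]
        unfolding limitin_metric comp_def by blast
      ultimately show "\<forall>\<^sub>F k in sequentially. (\<sigma> \<circ> (r \<circ> s)) k \<in> M \<and> d ((\<sigma> \<circ> (r \<circ> s)) k) l < \<epsilon>"
      proof eventually_elim
        case (elim k)
        have bM: "b (r (s k)) \<in> M"
          using nb(1) BM by blast
        then have "d (?\<tau> (s k)) (\<sigma> (r (s k))) < \<epsilon>/2"
          using \<delta>[OF bM] elim(1) by (simp add: nb(2) commute)
        moreover have "?\<tau> (s k) \<in> M" "\<sigma> (r (s k)) \<in> M"
          using in_M a nb by auto
        ultimately show ?case
          using elim(2) triangle[of "\<sigma> (r (s k))" "?\<tau> (s k)" l] \<open>l \<in> M\<close>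
          by (simp add: commute)
      qed
    qed
    with r s show ?thesis
      using strict_mono_o by blast
  qed
  moreover have "(\<Union>n::int. int_iterate M h n ` B) \<subseteq> M"
    using in_M by blast
  ultimately show ?thesis
    by (simp add: compact_closure_of_sequentially)
qed

section \<open>Invariant compact sets and local completeness\<close>

lemma almost_periodic_restrict:
  assumes h: "almost_periodic h" and A: "A \<subseteq> M" "h ` A = A"
  shows "Metric_space.almost_periodic A d h"
proof -
  interpret A: Submetric M d A
    using A by unfold_locales
  note bij = almost_periodic_bij_betw[OF h]
  have "homeomorphic_map mtopology mtopology h"
    using h by (simp add: almost_periodic_def)
  then have "homeomorphic_map A.sub.mtopology A.sub.mtopology h"
    unfolding A.mtopology_submetric using A
    by (intro homeomorphic_map_subtopologies) (auto simp: Int_absorb1)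
  then show ?thesis
    using h A(1) int_iterate_subset[OF bij A]
    unfolding A.sub.almost_periodic_def almost_periodic_def
    by (auto simp: subset_iff) metis
qed

lemma compactin_imp_locally_mcomplete:
  assumes "compactin mtopology S"
  shows "Metric_space.locally_mcomplete S d"
proof -
  interpret S: Submetric M d S
    using compactin_subset_topspace[OF assms] by unfold_locales simp
  have "compact_space S.sub.mtopology"
    using assms by (simp add: S.mtopology_submetric compactin_subspace)
  have "Metric_space.mcomplete (S.sub.mtopology closure_of S.sub.mball y \<epsilon>) d"
    (is "Metric_space.mcomplete ?C d") for y \<epsilon>
  proof -
    have "compactin S.sub.mtopology ?C"
      by (simp add: \<open>compact_space S.sub.mtopology\<close> closedin_compact_space)
    moreover have "?C \<subseteq> S"
      using closure_of_subset_topspace[of S.sub.mtopology] by auto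
    ultimately show ?thesis
      using S.sub.compactin_iff_mcomplete_mtotally_bounded by blast
  qed
  then show ?thesis
    using S.sub.locally_mcomplete_def zero_less_one by blast
qed

end

theorem theorem3:
  fixes X :: "'a set" and d :: "'a \<Rightarrow> 'a \<Rightarrow> real" and h :: "'a \<Rightarrow> 'a"
  assumes "Metric_space X d"
    and "Metric_space.almost_periodic X d h"
  shows "compactly_almost_periodic (Metric_space.mtopology X d) h \<longleftrightarrow>
    (\<forall>x\<in>X. Metric_space.locally_mcomplete
       (Metric_space.mtopology X d closure_of {int_iterate X h n x |n::int. True}) d)"
proof -
  interpret Metric_space X d
    by fact
  note h = assms(2)
  have orbit: "{int_iterate X h n x |n::int. True} = range (\<lambda>n. int_iterate X h n x)" for x
    by auto
  show ?thesis
    unfolding orbit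
  proof (intro iffI ballI)
    fix x
    assume "compactly_almost_periodic mtopology h" and "x \<in> X"
    moreover have "compactin mtopology {x}"
      using \<open>x \<in> X\<close> by simp
    ultimately have "compactin mtopology (mtopology closure_of (\<Union>n::int. int_iterate X h n ` {x}))"
      unfolding compactly_almost_periodic_def topspace_mtopology by blast
    moreover have "(\<Union>n::int. int_iterate X h n ` {x}) = range (\<lambda>n. int_iterate X h n x)"
      by auto
    ultimately show "Metric_space.locally_mcomplete
        (mtopology closure_of range (\<lambda>n. int_iterate X h n x)) d"
      by (simp add: compactin_imp_locally_mcomplete)
  next
    assume lc: "\<forall>x\<in>X. Metric_space.locally_mcomplete
        (mtopology closure_of range (\<lambda>n. int_iterate X h n x)) d"
    show "compactly_almost_periodic mtopology h"
      unfolding compactly_almost_periodic_def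
    proof (intro conjI strip)
      show "metrizable_space mtopology"
        by (rule metrizable_space_mtopology)
      show "homeomorphic_map mtopology mtopology h"
        using h by (simp add: almost_periodic_def)
    next
      fix B
      assume B: "compactin mtopology B"
      then have "B \<subseteq> X"
        using compactin_subset_topspace by fastforce
      with h B lc show "compactin mtopology
          (mtopology closure_of (\<Union>n::int. int_iterate (topspace mtopology) h n ` B))"
        using almost_periodic_compact_orbit_closure almost_periodic_compact_saturation
        by (simp add: subset_iff)
    next
      fix A
      assume A: "compactin mtopology A \<and> h ` A = A"
      then have "A \<subseteq> X"
        using compactin_subset_topspace by fastforce
      then interpret A: Submetric X d A
        by unfold_locales
      show "\<exists>d'. Metric_space A d' \<and> Metric_space.mtopology A d' = subtopology mtopology A \<and>
          Metric_space.almost_periodic A d' h"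
        using A.mtopology_submetric A.sub.Metric_space_axioms almost_periodic_restrict[OF h] A \<open>A \<subseteq> X\<close>
        by blast
    qed
  qed
qed

end
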